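(* Suppose that a minimal surface $\Sigma=\{z=u(x,y)\}\subset\mathbb{E}^3$ is invariant with respect to a contact symmetry $\varphi(u_x,u_y)$, not identically zero, of the minimal surface equation $$(1+u_y^2)\,u_{xx}-2u_xu_yu_{xy}+(1+u_x^2)\,u_{yy}=0.$$ Then $\Sigma$ is a plane.
   Context: $\mathbb{E}^3$ is Euclidean space with Cartesian coordinates $x,y,z$. Minimal surfaces are considered in nonparametric form $\Sigma=\{z=u(x,y)\}$, where $u$ is a smooth real solution, on a connected open domain of the $(x,y)$-plane, of the minimal surface equation; "is a plane" means that $\Sigma$ is (a piece of) a plane, i.e. $u_x$ and $u_y$ are constant. A contact symmetry depending only on $u_x,u_y$ is a smooth function $\varphi(u_x,u_y)$ (on a connected open set of values of $(u_x,u_y)$) which generates an infinitesimal symmetry $u_t=\varphi(u_x,u_y)$ of the minimal surface equation; equivalently, $\phi(p,q)=\varphi(p,q)$ satisfies $(1+p^2)\,\phi_{pp}+2pq\,\phi_{pq}+(1+q^2)\,\phi_{qq}=0$. The surface $\Sigma=\{z=u(x,y)\}$ is invariant with respect to $\varphi$ if $u$ satisfies the additional constraint $\varphi(u_x,u_y)=0$ on its domain. *)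

theory Defs
  imports "HOL-Analysis.Analysis"
begin

definition pdx :: "(real \<times> real \<Rightarrow> real) \<Rightarrow> real \<times> real \<Rightarrow> real" where
  "pdx f z = frechet_derivative f (at z) (1, 0)"

definition pdy :: "(real \<times> real \<Rightarrow> real) \<Rightarrow> real \<times> real \<Rightarrow> real" where
  "pdy f z = frechet_derivative f (at z) (0, 1)"

text \<open>Only meaningful for open \<open>S\<close>: derivatives are taken with respect to
  full neighbourhoods of the points of \<open>S\<close>.\<close>

primrec Ck_on :: "nat \<Rightarrow> (real \<times> real) set \<Rightarrow> (real \<times> real \<Rightarrow> real) \<Rightarrow> bool" where
  "Ck_on 0 S f \<longleftrightarrow> continuous_on S f"
| "Ck_on (Suc k) S f \<longleftrightarrow>
     (\<forall>z\<in>S. f differentiable (at z)) \<and> Ck_on k S (pdx f) \<and> Ck_on k S (pdy f)"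

definition smooth_on :: "(real \<times> real) set \<Rightarrow> (real \<times> real \<Rightarrow> real) \<Rightarrow> bool" where
  "smooth_on S f \<longleftrightarrow> (\<forall>k. Ck_on k S f)"

definition mse :: "(real \<times> real \<Rightarrow> real) \<Rightarrow> real \<times> real \<Rightarrow> real" where
  "mse u z =
     (1 + (pdy u z)\<^sup>2) * pdx (pdx u) z
     - 2 * pdx u z * pdy u z * pdy (pdx u) z
     + (1 + (pdx u z)\<^sup>2) * pdy (pdy u) z"

definition minimal_graph :: "(real \<times> real) set \<Rightarrow> (real \<times> real \<Rightarrow> real) \<Rightarrow> bool" where
  "minimal_graph D u \<longleftrightarrow>
     open D \<and> connected D \<and> smooth_on D u \<and> (\<forall>z\<in>D. mse u z = 0)"

text \<open>The flow \<open>u\<^sub>t = \<phi>(u\<^sub>x, u\<^sub>y)\<close> is an infinitesimal symmetry if it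
  preserves the minimal surface equation to first order at every solution:
  for each solution \<open>u\<close> whose gradient takes values in the domain \<open>U\<close> of \<open>\<phi>\<close>,
  the deformation \<open>u + \<epsilon> \<phi>(u\<^sub>x, u\<^sub>y)\<close> satisfies the equation up to
  \<open>o(\<epsilon>)\<close>.\<close>

definition contact_symmetry :: "(real \<times> real) set \<Rightarrow> (real \<times> real \<Rightarrow> real) \<Rightarrow> bool" where
  "contact_symmetry U \<phi> \<longleftrightarrow>
     open U \<and> connected U \<and> smooth_on U \<phi> \<and>
     (\<forall>V u. minimal_graph V u \<longrightarrow> (\<forall>z\<in>V. (pdx u z, pdy u z) \<in> U) \<longrightarrow>
        (\<forall>z\<in>V. ((\<lambda>\<epsilon>. mse (\<lambda>w. u w + \<epsilon> * \<phi> (pdx u w, pdy u w)) z)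
                   has_real_derivative 0) (at 0)))"

definition invariant_graph ::
  "(real \<times> real) set \<Rightarrow> (real \<times> real \<Rightarrow> real) \<Rightarrow>
   (real \<times> real) set \<Rightarrow> (real \<times> real \<Rightarrow> real) \<Rightarrow> bool" where
  "invariant_graph D u U \<phi> \<longleftrightarrow>
     (\<forall>z\<in>D. (pdx u z, pdy u z) \<in> U \<and> \<phi> (pdx u z, pdy u z) = 0)"

definition planar_graph :: "(real \<times> real) set \<Rightarrow> (real \<times> real \<Rightarrow> real) \<Rightarrow> bool" where
  "planar_graph D u \<longleftrightarrow> (\<exists>a b. \<forall>z\<in>D. pdx u z = a \<and> pdy u z = b)"

lemma planar_graph_iff_affine:
  assumes "open D" "connected D" "smooth_on D u"
  shows "planar_graph D u \<longleftrightarrow>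
    (\<exists>a b c. (\<lambda>z. (fst z, snd z, u z)) ` D \<subseteq> {(x, y, z). z = a * x + b * y + c})"
proof
  have "Ck_on (Suc 0) D u"
    using assms(3) unfolding smooth_on_def by blast
  then have diff: "u differentiable (at z)" if "z \<in> D" for z
    using that by simp
  assume "planar_graph D u"
  then obtain a b where ab: "\<And>z. z \<in> D \<Longrightarrow> pdx u z = a \<and> pdy u z = b"
    unfolding planar_graph_def by blast
  have "((\<lambda>z. u z - (a * fst z + b * snd z)) has_derivative (\<lambda>h. 0)) (at z)" if "z \<in> D" for z
  proof -
    let ?d = "frechet_derivative u (at z)"
    have d: "(u has_derivative ?d) (at z)"
      using diff[OF that] frechet_derivative_works by blast
    then interpret bounded_linear ?d
      by (rule has_derivative_bounded_linear)
    have "?d h = a * fst h + b * snd h" for h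
    proof -
      have "h = fst h *\<^sub>R (1, 0) + snd h *\<^sub>R (0, 1)"
        by (cases h) simp
      then have "?d h = fst h *\<^sub>R ?d (1, 0) + snd h *\<^sub>R ?d (0, 1)"
        by (metis add scaleR)
      then show ?thesis
        using ab[OF that] by (simp add: pdx_def pdy_def mult.commute)
    qed
    then have "?d = (\<lambda>h. a * fst h + b * snd h)"
      by blast
    with d have "(u has_derivative (\<lambda>h. a * fst h + b * snd h)) (at z)"
      by simp
    then show ?thesis
      by (auto intro!: derivative_eq_intros)
  qed
  then have "u z - (a * fst z + b * snd z) = u w - (a * fst w + b * snd w)"
    if "z \<in> D" "w \<in> D" for z w
    using has_derivative_zero_unique_connected[OF assms(1,2),
        of "\<lambda>z. u z - (a * fst z + b * snd z)"] that by blast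
  then obtain c where "\<And>z. z \<in> D \<Longrightarrow> u z - (a * fst z + b * snd z) = c"
    by metis
  then show "\<exists>a b c. (\<lambda>z. (fst z, snd z, u z)) ` D \<subseteq> {(x, y, z). z = a * x + b * y + c}"
    by (intro exI[of _ a] exI[of _ b] exI[of _ c]) (force simp: algebra_simps)
next
  assume "\<exists>a b c. (\<lambda>z. (fst z, snd z, u z)) ` D \<subseteq> {(x, y, z). z = a * x + b * y + c}"
  then obtain a b c where u: "\<And>z. z \<in> D \<Longrightarrow> a * fst z + b * snd z + c = u z"
    by (fastforce simp: image_subset_iff)
  have "(u has_derivative (\<lambda>h. a * fst h + b * snd h)) (at z)" if "z \<in> D" for z
    by (rule has_derivative_transform_within_open[OF _ assms(1) that u])
      (auto intro!: derivative_eq_intros)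
  then have "frechet_derivative u (at z) = (\<lambda>h. a * fst h + b * snd h)" if "z \<in> D" for z
    using that frechet_derivative_at by metis
  then show "planar_graph D u"
    unfolding planar_graph_def pdx_def pdy_def by auto
qed

end

theory Submission
  imports Defs "HOL-Complex_Analysis.Complex_Analysis"
begin

text \<open>
  The characteristic \<open>\<phi>\<close> of a contact symmetry depending only on the gradient \<open>(p, q)\<close> satisfies
  the linear elliptic equation
  \<open>(1 + p\<^sup>2) \<phi>\<^sub>p\<^sub>p + 2pq \<phi>\<^sub>p\<^sub>q + (1 + q\<^sup>2) \<phi>\<^sub>q\<^sub>q = 0\<close> on its domain
  (lemma \<open>contact_symmetry_equation\<close>). To see this it is enough to test the symmetry condition on
  one surface, the Scherk graph \<open>z = ln (cos y) - ln (cos x)\<close>: its gradient \<open>(tan x, - tan y)\<close> takes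
  every value, and its Hessian is nowhere degenerate.

  Suppose now that \<open>\<phi>(u\<^sub>x, u\<^sub>y) = 0\<close>. If the Hessian determinant of \<open>u\<close> is nonzero at some point, the
  gradient map is open there, so \<open>\<phi>\<close> vanishes on a nonempty open set (\<open>gradient_image_interior\<close>),
  hence on all of its connected domain by unique continuation (\<open>symmetry_unique_continuation\<close>), which
  was excluded. So the determinant vanishes identically; together with the minimal surface equation,
  which is elliptic, this makes the whole Hessian vanish (\<open>minimal_hessian_zero\<close>), and the gradient
  is constant.

  Unique continuation is obtained from complex analysis. The equation for \<open>\<phi>\<close> says that \<open>\<phi>\<close> is the
  Legendre transform of a (possibly degenerate) minimal graph, with \<open>x = \<phi>\<^sub>p\<close> and \<open>y = \<phi>\<^sub>q\<close>. Stereographic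
  projection of the Gauss image gives a parameter \<open>\<zeta> = a + ib\<close> in the unit disc with
  \<open>(p, q) = (2a, 2b) / (1 - a\<^sup>2 - b\<^sup>2)\<close>, and with respect to it \<open>f = \<partial>(\<phi>\<^sub>p - i \<phi>\<^sub>q)/\<partial>\<zeta>\<close>, the coefficient in the
  Weierstrass representation, is holomorphic (\<open>weierstrass_holomorphic\<close>). It is a combination of
  the second derivatives of \<open>\<phi>\<close>, which it determines completely in view of the equation
  (\<open>weierstrass_zero_imp\<close>), so that the identity theorem applies to the Hessian of \<open>\<phi>\<close>.
\<close>

section \<open>Partial derivatives\<close>

lemma has_derivative_partials:
  assumes "f differentiable (at z)"
  shows "(f has_derivative (\<lambda>h. fst h * pdx f z + snd h * pdy f z)) (at z)"
proof -
  let ?d = "frechet_derivative f (at z)"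
  have d: "(f has_derivative ?d) (at z)"
    using assms frechet_derivative_works by blast
  then interpret bounded_linear ?d
    by (rule has_derivative_bounded_linear)
  have "?d h = fst h * pdx f z + snd h * pdy f z" for h
  proof -
    have "h = fst h *\<^sub>R (1, 0) + snd h *\<^sub>R (0, 1)"
      by (cases h) simp
    then have "?d h = fst h *\<^sub>R ?d (1, 0) + snd h *\<^sub>R ?d (0, 1)"
      by (metis add scaleR)
    then show ?thesis
      by (simp add: pdx_def pdy_def)
  qed
  then have "?d = (\<lambda>h. fst h * pdx f z + snd h * pdy f z)"
    by blast
  with d show ?thesis by simp
qed

lemma partials_eqI:
  assumes "(f has_derivative (\<lambda>h. fst h * a + snd h * b)) (at z)"
  shows "f differentiable (at z)" "pdx f z = a" "pdy f z = b"
proof -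
  have eq: "(\<lambda>h. fst h * a + snd h * b) = frechet_derivative f (at z)"
    using assms by (rule frechet_derivative_at)
  show "pdx f z = a" "pdy f z = b"
    by (simp_all add: pdx_def pdy_def flip: eq)
  show "f differentiable (at z)"
    using assms differentiable_def by blast
qed

lemma has_derivative_compose_pair:
  fixes a b :: "'a::real_normed_vector \<Rightarrow> real"
  assumes "g differentiable (at (a z, b z))"
    and "(a has_derivative a') (at z)" "(b has_derivative b') (at z)"
  shows "((\<lambda>w. g (a w, b w)) has_derivative
           (\<lambda>h. a' h * pdx g (a z, b z) + b' h * pdy g (a z, b z))) (at z)"
proof -
  have "((\<lambda>w. (a w, b w)) has_derivative (\<lambda>h. (a' h, b' h))) (at z)"
    using assms(2,3) by (rule has_derivative_Pair)
  from has_derivative_compose[OF this has_derivative_partials[OF assms(1)]]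
  show ?thesis by simp
qed

lemma partials_cong:
  assumes "open S" "z \<in> S" and eq: "\<And>w. w \<in> S \<Longrightarrow> f w = g w"
  shows "f differentiable (at z) \<longleftrightarrow> g differentiable (at z)"
    and "pdx f z = pdx g z" and "pdy f z = pdy g z"
proof -
  have *: "(f has_derivative d) (at z) \<longleftrightarrow> (g has_derivative d) (at z)" for d
    using has_derivative_transform_within_open[OF _ assms(1,2)] eq by (metis (no_types))
  show "f differentiable (at z) \<longleftrightarrow> g differentiable (at z)"
    by (simp add: differentiable_def *)
  show "pdx f z = pdx g z" "pdy f z = pdy g z"
    by (simp_all add: pdx_def pdy_def frechet_derivative_def *)
qed

lemma partials_zero:
  assumes "open S" "z \<in> S" "\<And>w. w \<in> S \<Longrightarrow> f w = 0"
  shows "pdx f z = 0" "pdy f z = 0"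
proof -
  have "((\<lambda>w. 0::real) has_derivative (\<lambda>h. fst h * 0 + snd h * 0)) (at z)"
    by simp
  from partials_eqI(2,3)[OF this] partials_cong(2,3)[OF assms(1,2), of f "\<lambda>w. 0"] assms(3)
  show "pdx f z = 0" "pdy f z = 0" by auto
qed

lemma Ck_on_cong:
  assumes "open S" "\<And>w. w \<in> S \<Longrightarrow> f w = g w" "Ck_on k S f"
  shows "Ck_on k S g"
  using assms(2,3)
proof (induction k arbitrary: f g)
  case 0
  then show ?case
    using continuous_on_cong[of S S f g] by simp
next
  case (Suc k)
  have c: "f differentiable (at z) \<longleftrightarrow> g differentiable (at z)"
    "pdx f z = pdx g z" "pdy f z = pdy g z" if "z \<in> S" for z
    using partials_cong[OF assms(1) that, of f g] Suc.prems(1) by blast+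
  have "Ck_on k S (pdx g)" "Ck_on k S (pdy g)"
    using Suc.IH[of "pdx f" "pdx g"] Suc.IH[of "pdy f" "pdy g"] c Suc.prems(2) by auto
  then show ?case
    using c Suc.prems(2) by auto
qed

lemma partials_zero_imp_constant:
  assumes "open S" "connected S" "\<And>z. z \<in> S \<Longrightarrow> f differentiable (at z)"
    and "\<And>z. z \<in> S \<Longrightarrow> pdx f z = 0" "\<And>z. z \<in> S \<Longrightarrow> pdy f z = 0"
    and "z \<in> S" "w \<in> S"
  shows "f z = f w"
proof (rule has_derivative_zero_unique_connected[OF assms(1,2) _ assms(6,7)])
  fix z assume "z \<in> S"
  then show "(f has_derivative (\<lambda>x. 0)) (at z)"
    using has_derivative_partials[of f z] assms by simp
qed

lemma continuous_on_if_differentiable: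
  assumes "\<And>z. z \<in> S \<Longrightarrow> f differentiable (at z)"
  shows "continuous_on S f"
  using assms by (meson continuous_at_imp_continuous_on differentiable_imp_continuous_within)

lemma DERIV_pdx:
  assumes "f differentiable (at (x, y))"
  shows "((\<lambda>s. f (s, y)) has_real_derivative pdx f (x, y)) (at x)"
proof -
  have "((\<lambda>s. f (s, y)) has_derivative (\<lambda>h. h * pdx f (x, y) + 0 * pdy f (x, y))) (at x)"
    using assms by (intro has_derivative_compose_pair) (auto intro!: derivative_eq_intros)
  then show ?thesis
    by (simp add: has_field_derivative_def mult_commute_abs)
qed

lemma DERIV_pdy:
  assumes "f differentiable (at (x, y))"
  shows "((\<lambda>s. f (x, s)) has_real_derivative pdy f (x, y)) (at y)"
proof -
  have "((\<lambda>s. f (x, s)) has_derivative (\<lambda>h. 0 * pdx f (x, y) + h * pdy f (x, y))) (at y)"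
    using assms by (intro has_derivative_compose_pair) (auto intro!: derivative_eq_intros)
  then show ?thesis
    by (simp add: has_field_derivative_def mult_commute_abs)
qed

text \<open>The two mean values below express the same second difference of \<open>f\<close> over a square of
  side \<open>h\<close>, and both points tend to the corner as \<open>h\<close> tends to \<open>0\<close>.\<close>

lemma mixed_partials_commute:
  assumes "open S" "Ck_on 2 S f" "z \<in> S"
  shows "pdy (pdx f) z = pdx (pdy f) z"
proof -
  have C: "Ck_on (Suc (Suc 0)) S f"
    using assms(2) by (simp add: numeral_2_eq_2)
  obtain x y where z: "z = (x, y)" by (cases z)
  have df: "f differentiable (at w)" "pdx f differentiable (at w)" "pdy f differentiable (at w)"
    if "w \<in> S" for w using that C by auto
  have cont: "continuous_on S (pdy (pdx f))" "continuous_on S (pdx (pdy f))"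
    using C by auto
  obtain e where e: "e > 0" "ball z e \<subseteq> S"
    using assms(1,3) openE by blast
  have box: "(s, t) \<in> ball z e"
    if "h < e / 2" "x \<le> s" "s \<le> x + h" "y \<le> t" "t \<le> y + h" for s t h
  proof -
    have "dist z (s, t) \<le> \<bar>x - s\<bar> + \<bar>y - t\<bar>"
      unfolding z dist_Pair_Pair dist_real_def using sqrt_sum_squares_le_sum_abs by simp
    then show ?thesis using that by simp
  qed
  have ex: "\<exists>w1 w2. w1 \<in> S \<and> w2 \<in> S \<and> dist z w1 \<le> 2 * h \<and> dist z w2 \<le> 2 * h \<and>
      pdy (pdx f) w1 = pdx (pdy f) w2" if h: "0 < h" "h < e / 2" for h
  proof -
    let ?\<Delta> = "f (x + h, y + h) - f (x + h, y) - f (x, y + h) + f (x, y)"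
    have inS: "(s, t) \<in> S" if "x \<le> s" "s \<le> x + h" "y \<le> t" "t \<le> y + h" for s t
      using box[OF h(2)] that e by blast
    have "\<exists>\<xi>. x < \<xi> \<and> \<xi> < x + h \<and> (f (x + h, y + h) - f (x + h, y)) - (f (x, y + h) - f (x, y))
        = (x + h - x) * (pdx f (\<xi>, y + h) - pdx f (\<xi>, y))"
      using h by (intro MVT2) (auto intro!: derivative_eq_intros DERIV_pdx df inS)
    then obtain \<xi> where \<xi>: "x < \<xi>" "\<xi> < x + h" "?\<Delta> = h * (pdx f (\<xi>, y + h) - pdx f (\<xi>, y))"
      by (auto simp: algebra_simps)
    have "\<exists>\<eta>. y < \<eta> \<and> \<eta> < y + h \<and> pdx f (\<xi>, y + h) - pdx f (\<xi>, y)
        = (y + h - y) * pdy (pdx f) (\<xi>, \<eta>)"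
      using h \<xi> by (intro MVT2) (auto intro!: DERIV_pdy df inS)
    then obtain \<eta> where \<eta>: "y < \<eta>" "\<eta> < y + h" "?\<Delta> = h * (h * pdy (pdx f) (\<xi>, \<eta>))"
      using \<xi>(3) by auto
    have "\<exists>\<mu>. y < \<mu> \<and> \<mu> < y + h \<and> (f (x + h, y + h) - f (x, y + h)) - (f (x + h, y) - f (x, y))
        = (y + h - y) * (pdy f (x + h, \<mu>) - pdy f (x, \<mu>))"
      using h by (intro MVT2) (auto intro!: derivative_eq_intros DERIV_pdy df inS)
    then obtain \<mu> where \<mu>: "y < \<mu>" "\<mu> < y + h" "?\<Delta> = h * (pdy f (x + h, \<mu>) - pdy f (x, \<mu>))"
      by (auto simp: algebra_simps)
    have "\<exists>\<nu>. x < \<nu> \<and> \<nu> < x + h \<and> pdy f (x + h, \<mu>) - pdy f (x, \<mu>)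
        = (x + h - x) * pdx (pdy f) (\<nu>, \<mu>)"
      using h \<mu> by (intro MVT2) (auto intro!: DERIV_pdx df inS)
    then obtain \<nu> where \<nu>: "x < \<nu>" "\<nu> < x + h" "?\<Delta> = h * (h * pdx (pdy f) (\<nu>, \<mu>))"
      using \<mu>(3) by auto
    have near: "dist z (s, t) \<le> 2 * h" if "x < s" "s < x + h" "y < t" "t < y + h" for s t
    proof -
      have "dist z (s, t) \<le> \<bar>x - s\<bar> + \<bar>y - t\<bar>"
        unfolding z dist_Pair_Pair dist_real_def using sqrt_sum_squares_le_sum_abs by simp
      then show ?thesis using that by simp
    qed
    have "pdy (pdx f) (\<xi>, \<eta>) = pdx (pdy f) (\<nu>, \<mu>)"
      using \<eta>(3) \<nu>(3) h by simp
    moreover have "(\<xi>, \<eta>) \<in> S" "(\<nu>, \<mu>) \<in> S"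
      using \<xi> \<eta> \<mu> \<nu> by (auto intro!: inS)
    ultimately show ?thesis
      using near \<xi> \<eta> \<mu> \<nu> by blast
  qed
  have "\<bar>pdy (pdx f) z - pdx (pdy f) z\<bar> < \<epsilon>" if "\<epsilon> > 0" for \<epsilon>
  proof -
    obtain d1 where d1: "d1 > 0"
      "\<And>w. w \<in> S \<Longrightarrow> dist w z < d1 \<Longrightarrow> dist (pdy (pdx f) w) (pdy (pdx f) z) < \<epsilon> / 2"
      using cont(1) assms(3) \<open>\<epsilon> > 0\<close> unfolding continuous_on_iff by (meson half_gt_zero)
    obtain d2 where d2: "d2 > 0"
      "\<And>w. w \<in> S \<Longrightarrow> dist w z < d2 \<Longrightarrow> dist (pdx (pdy f) w) (pdx (pdy f) z) < \<epsilon> / 2"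
      using cont(2) assms(3) \<open>\<epsilon> > 0\<close> unfolding continuous_on_iff by (meson half_gt_zero)
    define h where "h = min (e / 4) (min (d1 / 4) (d2 / 4))"
    have h: "0 < h" "h < e / 2" "2 * h < d1" "2 * h < d2"
      using e d1(1) d2(1) by (auto simp: h_def min_def)
    obtain w1 w2 where w: "w1 \<in> S" "w2 \<in> S" "dist z w1 \<le> 2 * h" "dist z w2 \<le> 2 * h"
      "pdy (pdx f) w1 = pdx (pdy f) w2"
      using ex[OF h(1,2)] by blast
    have "dist (pdy (pdx f) w1) (pdy (pdx f) z) < \<epsilon> / 2"
      "dist (pdx (pdy f) w2) (pdx (pdy f) z) < \<epsilon> / 2"
      using d1(2)[OF w(1)] d2(2)[OF w(2)] w(3,4) h by (simp_all add: dist_commute)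
    then show ?thesis
      unfolding w(5) dist_real_def by linarith
  qed
  then have "\<bar>pdy (pdx f) z - pdx (pdy f) z\<bar> \<le> 0"
    using field_le_epsilon[of _ 0] by (metis add_0 less_imp_le)
  then show ?thesis by simp
qed

section \<open>The Scherk surface and the equation for the symmetry\<close>

text \<open>The Scherk graph lives over the square \<open>\<bar>x\<bar>, \<bar>y\<bar> < \<pi>/2\<close>. Its domain is encoded by
  the sign of the cosines, so it also contains the translates of this square by multiples of \<open>2\<pi>\<close>
  in \<open>x\<close> and in \<open>y\<close>.\<close>

definition scherk :: "real \<times> real \<Rightarrow> real" where
  "scherk z = ln (cos (snd z)) - ln (cos (fst z))"

definition scherk_domain :: "(real \<times> real) set" where
  "scherk_domain = {z. 0 < cos (fst z) \<and> 0 < cos (snd z)}"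

lemma open_scherk_domain: "open scherk_domain"
  unfolding scherk_domain_def
  by (intro open_Collect_conj open_Collect_less continuous_intros)

lemma tan_has_derivative:
  fixes a :: "'a::real_normed_vector \<Rightarrow> real"
  assumes "(a has_derivative a') (at z)" "cos (a z) \<noteq> 0"
  shows "((\<lambda>w. tan (a w)) has_derivative (\<lambda>h. a' h * (1 + (tan (a z))\<^sup>2))) (at z)"
proof -
  have "(tan has_real_derivative 1 + (tan (a z))\<^sup>2) (at (a z))"
    using DERIV_tan[OF assms(2)] by (simp add: tan_sec[OF assms(2)] power_inverse)
  from has_derivative_compose[OF assms(1) this[unfolded has_field_derivative_def]]
  show ?thesis by (simp add: mult.commute)
qed

lemma continuous_on_tan_compose:
  fixes a :: "'a::topological_space \<Rightarrow> real"
  assumes "continuous_on S a" "\<And>z. z \<in> S \<Longrightarrow> cos (a z) \<noteq> 0"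
  shows "continuous_on S (\<lambda>z. tan (a z))"
  by (rule continuous_on_compose2[OF _ assms(1), of "{t. cos t \<noteq> 0}"])
    (use assms(2) in \<open>auto intro!: continuous_at_imp_continuous_on\<close>)

text \<open>This class of functions contains both partial derivatives of the Scherk graph and is closed
  under \<open>pdx\<close> and \<open>pdy\<close>, because \<open>tan' = 1 + tan\<^sup>2\<close>.\<close>

lemma Ck_on_poly_tan:
  assumes "open V" "V \<subseteq> scherk_domain"
  shows "Ck_on k V (\<lambda>z. poly P (tan (fst z)) + poly Q (tan (snd z)))"
proof (induction k arbitrary: P Q)
  case 0
  have "cos (fst z) \<noteq> 0" "cos (snd z) \<noteq> 0" if "z \<in> V" for z
    using that assms(2) by (auto simp: scherk_domain_def)
  then show ?case
    by (auto intro!: continuous_intros continuous_on_tan_compose)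
next
  case (Suc k)
  let ?f = "\<lambda>z. poly P (tan (fst z)) + poly Q (tan (snd z))"
  let ?P = "pderiv P * [:1, 0, 1:]" and ?Q = "pderiv Q * [:1, 0, 1:]"
  have d: "(?f has_derivative (\<lambda>h. fst h * (poly ?P (tan (fst z)) + poly 0 (tan (snd z)))
      + snd h * (poly 0 (tan (fst z)) + poly ?Q (tan (snd z))))) (at z)" if "z \<in> V" for z
  proof -
    have c: "cos (fst z) \<noteq> 0" "cos (snd z) \<noteq> 0"
      using that assms(2) by (auto simp: scherk_domain_def)
    have p: "(poly R has_derivative (\<lambda>h. h * poly (pderiv R) t)) (at t)" for R and t :: real
      using poly_DERIV[of R t] by (simp add: has_field_derivative_def mult_commute_abs)
    have t: "((\<lambda>z. tan (fst z)) has_derivative (\<lambda>h. fst h * (1 + (tan (fst z))\<^sup>2))) (at z)"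
      "((\<lambda>z. tan (snd z)) has_derivative (\<lambda>h. snd h * (1 + (tan (snd z))\<^sup>2))) (at z)"
      using c by (auto intro!: tan_has_derivative derivative_intros)
    show ?thesis
      using has_derivative_add[OF has_derivative_compose[OF t(1) p[of P]]
          has_derivative_compose[OF t(2) p[of Q]]]
      by (simp add: algebra_simps power2_eq_square)
  qed
  note D = partials_eqI[OF d]
  have "Ck_on k V (pdx ?f)" "Ck_on k V (pdy ?f)"
    by (rule Ck_on_cong[OF assms(1) _ Suc.IH[of ?P 0]], simp only: D)
      (rule Ck_on_cong[OF assms(1) _ Suc.IH[of 0 ?Q]], simp only: D)
  then show ?case
    using D(1) by auto
qed

lemma has_derivative_scherk:
  assumes "z \<in> scherk_domain"
  shows "(scherk has_derivative (\<lambda>h. fst h * tan (fst z) + snd h * (- tan (snd z)))) (at z)"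
proof -
  have c: "0 < cos (fst z)" "0 < cos (snd z)"
    using assms by (auto simp: scherk_domain_def)
  show ?thesis
    unfolding scherk_def[abs_def] using c
    by (auto intro!: derivative_eq_intros simp: tan_def field_simps)
qed

lemmas scherk_partials = partials_eqI[OF has_derivative_scherk]

lemma minimal_graph_scherk:
  assumes "open V" "connected V" "V \<subseteq> scherk_domain"
  shows "minimal_graph V scherk"
proof -
  have "Ck_on k V scherk" for k
  proof (cases k)
    case 0
    then show ?thesis
      using continuous_on_if_differentiable[of V scherk] scherk_partials(1) assms(3) by auto
  next
    case (Suc j)
    have "Ck_on j V (pdx scherk)"
      by (rule Ck_on_cong[OF assms(1) _ Ck_on_poly_tan[OF assms(1,3), of _ "[:0, 1:]" 0]])
        (use assms(3) scherk_partials in auto)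
    moreover have "Ck_on j V (pdy scherk)"
      by (rule Ck_on_cong[OF assms(1) _ Ck_on_poly_tan[OF assms(1,3), of _ 0 "[:0, -1:]"]])
        (use assms(3) scherk_partials in auto)
    ultimately show ?thesis
      using Suc scherk_partials(1) assms(3) by auto
  qed
  moreover have "mse scherk z = 0" if "z \<in> V" for z
  proof -
    have z: "z \<in> scherk_domain" using that assms by auto
    then have c: "cos (fst z) \<noteq> 0" "cos (snd z) \<noteq> 0"
      by (auto simp: scherk_domain_def)
    have "((\<lambda>z. tan (fst z)) has_derivative
        (\<lambda>h. fst h * (1 + (tan (fst z))\<^sup>2) + snd h * 0)) (at z)"
      using tan_has_derivative[OF has_derivative_fst[OF has_derivative_ident], of z] c by simp
    note x = partials_eqI[OF this]
    have "((\<lambda>z. - tan (snd z)) has_derivative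
        (\<lambda>h. fst h * 0 + snd h * (- (1 + (tan (snd z))\<^sup>2)))) (at z)"
      using has_derivative_minus[OF tan_has_derivative[OF
            has_derivative_snd[OF has_derivative_ident], of z]] c
      by (simp only: mult_minus_right mult_zero_right add_0_left not_False_eq_True)
    note y = partials_eqI[OF this]
    have "pdx (pdx scherk) z = 1 + (tan (fst z))\<^sup>2" "pdy (pdx scherk) z = 0"
      "pdy (pdy scherk) z = - (1 + (tan (snd z))\<^sup>2)"
      using partials_cong[OF open_scherk_domain z scherk_partials(2)] x
        partials_cong[OF open_scherk_domain z scherk_partials(3)] y by auto
    then show ?thesis
      unfolding mse_def scherk_partials[OF z] by algebra
  qed
  ultimately show ?thesis
    using assms by (auto simp: minimal_graph_def smooth_on_def)
qed

text \<open>The first variation of the minimal surface operator at the Scherk graph, in the direction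
  \<open>\<phi>(tan x, - tan y)\<close>, equals \<open>(1 + p\<^sup>2) (1 + q\<^sup>2)\<close> times the left-hand side below: the terms
  with first derivatives of \<open>\<phi>\<close> cancel.\<close>

lemma contact_symmetry_equation:
  assumes sym: "contact_symmetry U \<phi>" and "w \<in> U"
  shows "(1 + (fst w)\<^sup>2) * pdx (pdx \<phi>) w + 2 * fst w * snd w * pdy (pdx \<phi>) w
    + (1 + (snd w)\<^sup>2) * pdy (pdy \<phi>) w = 0"
proof -
  have U: "open U" "Ck_on (Suc (Suc 0)) U \<phi>"
    using sym unfolding contact_symmetry_def smooth_on_def by blast+
  have diff: "\<phi> differentiable (at v)" "pdx \<phi> differentiable (at v)"
    "pdy \<phi> differentiable (at v)" if "v \<in> U" for v
    using U(2) that by auto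
  obtain p q where w: "w = (p, q)" by (cases w)
  define z0 where "z0 = (arctan p, - arctan q)"
  define T where "T z = (tan (fst z), - tan (snd z))" for z :: "real \<times> real"
  have Tz0: "T z0 = w"
    by (simp add: T_def z0_def w tan_arctan)
  have z0: "z0 \<in> scherk_domain"
    by (simp add: scherk_domain_def z0_def cos_arctan add_pos_nonneg)
  have "continuous_on scherk_domain T"
    unfolding T_def scherk_domain_def
    by (intro continuous_intros continuous_on_tan_compose) auto
  then have "open (T -` U \<inter> scherk_domain)"
    using continuous_on_open_vimage[OF open_scherk_domain] U(1) by blast
  moreover have "z0 \<in> T -` U \<inter> scherk_domain"
    using Tz0 z0 assms(2) by auto
  ultimately obtain e where e: "e > 0" "ball z0 e \<subseteq> T -` U \<inter> scherk_domain"
    using openE by blast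
  define V where "V = ball z0 e"
  have V: "open V" "connected V" "V \<subseteq> scherk_domain" "z0 \<in> V" "\<And>z. z \<in> V \<Longrightarrow> T z \<in> U"
    using e by (auto simp: V_def)
  have grad: "(pdx scherk z, pdy scherk z) = T z" if "z \<in> V" for z
    using scherk_partials[of z] V(3) that by (auto simp: T_def)
  define v where "v \<epsilon> z = scherk z + \<epsilon> * \<phi> (pdx scherk z, pdy scherk z)" for \<epsilon> z
  have deriv: "((\<lambda>\<epsilon>. mse (v \<epsilon>) z0) has_real_derivative 0) (at 0)"
    unfolding v_def
    using sym minimal_graph_scherk[OF V(1-3)] V(4,5) grad
    unfolding contact_symmetry_def by auto
  have tans: "((\<lambda>z. tan (fst z)) has_derivative (\<lambda>h. fst h * (1 + (tan (fst z))\<^sup>2))) (at z)"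
    "((\<lambda>z. tan (snd z)) has_derivative (\<lambda>h. snd h * (1 + (tan (snd z))\<^sup>2))) (at z)"
    if "z \<in> V" for z
    using V(3) that
    by (auto intro!: tan_has_derivative derivative_intros simp: scherk_domain_def)
  have comp: "((\<lambda>z. g (T z)) has_derivative (\<lambda>h. fst h * ((1 + (tan (fst z))\<^sup>2) * pdx g (T z))
      + snd h * (- (1 + (tan (snd z))\<^sup>2) * pdy g (T z)))) (at z)"
    if "z \<in> V" "g differentiable (at (T z))" for g z
    using has_derivative_compose_pair[OF that(2)[unfolded T_def] tans(1)[OF that(1)]
        has_derivative_minus[OF tans(2)[OF that(1)]]]
    by (simp add: T_def algebra_simps)
  have v: "(v \<epsilon> has_derivative
      (\<lambda>h. fst h * (tan (fst z) + \<epsilon> * ((1 + (tan (fst z))\<^sup>2) * pdx \<phi> (T z)))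
         + snd h * (- tan (snd z) - \<epsilon> * ((1 + (tan (snd z))\<^sup>2) * pdy \<phi> (T z))))) (at z)"
    if "z \<in> V" for z \<epsilon>
  proof (rule has_derivative_transform_within_open[OF _ V(1) that])
    have z: "z \<in> scherk_domain" using that V(3) by auto
    show "((\<lambda>z. scherk z + \<epsilon> * \<phi> (T z)) has_derivative
      (\<lambda>h. fst h * (tan (fst z) + \<epsilon> * ((1 + (tan (fst z))\<^sup>2) * pdx \<phi> (T z)))
         + snd h * (- tan (snd z) - \<epsilon> * ((1 + (tan (snd z))\<^sup>2) * pdy \<phi> (T z))))) (at z)"
      using has_derivative_add[OF has_derivative_scherk[OF z]
          has_derivative_mult_right[OF comp[OF that diff(1)[OF V(5)[OF that]]], of \<epsilon>]]
      by (simp add: algebra_simps)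
    show "scherk x + \<epsilon> * \<phi> (T x) = v \<epsilon> x" if "x \<in> V" for x
      using grad[OF that] by (simp add: v_def)
  qed
  define a b r s s' t where "a = pdx \<phi> w" and "b = pdy \<phi> w" and "r = pdx (pdx \<phi>) w"
    and "s = pdy (pdx \<phi>) w" and "s' = pdx (pdy \<phi>) w" and "t = pdy (pdy \<phi>) w"
  have fz: "tan (fst z0) = p" "tan (snd z0) = - q"
    by (simp_all add: z0_def tan_arctan)
  define P Q where "P = 1 + p\<^sup>2" and "Q = 1 + q\<^sup>2"
  have vx: "pdx (v \<epsilon>) z0 = p + \<epsilon> * (P * a)" and vy: "pdy (v \<epsilon>) z0 = q - \<epsilon> * (Q * b)" for \<epsilon>
    using partials_eqI(2,3)[OF v[OF V(4)]] by (simp_all add: fz Tz0 a_def b_def P_def Q_def)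
  have "((\<lambda>z. tan (fst z) + \<epsilon> * ((1 + (tan (fst z))\<^sup>2) * pdx \<phi> (T z))) has_derivative
     (\<lambda>h. fst h * (P + \<epsilon> * (P * (P * r) + 2 * p * P * a)) + snd h * (\<epsilon> * (P * (- Q * s))))) (at z0)"
    for \<epsilon>
    by (rule derivative_eq_intros tans(1)[OF V(4)] comp[OF V(4)] diff V(5)[OF V(4)] refl)+
      (simp add: fz Tz0 P_def Q_def a_def r_def s_def fun_eq_iff algebra_simps power2_eq_square)
  note vx2 = partials_eqI(2,3)[OF this]
  have "((\<lambda>z. - tan (snd z) - \<epsilon> * ((1 + (tan (snd z))\<^sup>2) * pdy \<phi> (T z))) has_derivative
     (\<lambda>h. fst h * (- \<epsilon> * (Q * (P * s'))) + snd h * (- Q - \<epsilon> * (Q * (- Q * t) - 2 * q * Q * b)))) (at z0)"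
    for \<epsilon>
    by (rule derivative_eq_intros tans(2)[OF V(4)] comp[OF V(4)] diff V(5)[OF V(4)] refl)+
      (simp add: fz Tz0 P_def Q_def b_def s'_def t_def fun_eq_iff algebra_simps power2_eq_square)
  note vy2 = partials_eqI(2,3)[OF this]
  have v2: "pdx (pdx (v \<epsilon>)) z0 = P + \<epsilon> * (P * (P * r) + 2 * p * P * a)"
    "pdy (pdx (v \<epsilon>)) z0 = \<epsilon> * (P * (- Q * s))"
    "pdy (pdy (v \<epsilon>)) z0 = - Q - \<epsilon> * (Q * (- Q * t) - 2 * q * Q * b)" for \<epsilon>
    using partials_cong(2,3)[OF V(1,4) partials_eqI(2)[OF v]] vx2
      partials_cong(2,3)[OF V(1,4) partials_eqI(3)[OF v]] vy2 by auto
  have "mse (v \<epsilon>) z0 =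
      (1 + (q - \<epsilon> * (Q * b))\<^sup>2) * (P + \<epsilon> * (P * (P * r) + 2 * p * P * a))
      - 2 * (p + \<epsilon> * (P * a)) * (q - \<epsilon> * (Q * b)) * (\<epsilon> * (P * (- Q * s)))
      + (1 + (p + \<epsilon> * (P * a))\<^sup>2) * (- Q - \<epsilon> * (Q * (- Q * t) - 2 * q * Q * b))" for \<epsilon>
    by (simp add: mse_def vx vy v2)
  moreover have "((\<lambda>\<epsilon>. (1 + (q - \<epsilon> * (Q * b))\<^sup>2) * (P + \<epsilon> * (P * (P * r) + 2 * p * P * a))
      - 2 * (p + \<epsilon> * (P * a)) * (q - \<epsilon> * (Q * b)) * (\<epsilon> * (P * (- Q * s)))
      + (1 + (p + \<epsilon> * (P * a))\<^sup>2) * (- Q - \<epsilon> * (Q * (- Q * t) - 2 * q * Q * b)))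
     has_real_derivative P * Q * (P * r + 2 * p * q * s + Q * t)) (at 0)"
    by (rule derivative_eq_intros refl)+ (simp add: P_def Q_def algebra_simps power2_eq_square)
  ultimately have "((\<lambda>\<epsilon>. mse (v \<epsilon>) z0) has_real_derivative
      P * Q * (P * r + 2 * p * q * s + Q * t)) (at 0)"
    by (simp only:)
  from DERIV_unique[OF this deriv] have "P * Q * (P * r + 2 * p * q * s + Q * t) = 0" .
  moreover have "P > 0" "Q > 0"
    by (simp_all add: P_def Q_def add_pos_nonneg)
  ultimately show ?thesis
    by (simp add: P_def Q_def r_def s_def t_def w)
qed

section \<open>Unique continuation for the symmetry\<close>

text \<open>The slope \<open>(p, q)\<close> of the tangent plane as a function of \<open>a + ib\<close>, the stereographic
  projection from the north pole of its downward unit normal. It maps the open unit disc diffeomorphically onto the plane.\<close>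

definition slope :: "complex \<Rightarrow> real \<times> real" where
  "slope w = (2 * Re w / (1 - (Re w)\<^sup>2 - (Im w)\<^sup>2), 2 * Im w / (1 - (Re w)\<^sup>2 - (Im w)\<^sup>2))"

text \<open>The stereographic projection of the downward unit normal \<open>(p, q, -1) / sqrt (1 + p\<^sup>2 + q\<^sup>2)\<close>.\<close>

definition slope_inv :: "real \<times> real \<Rightarrow> complex" where
  "slope_inv z = (let W = 1 + sqrt (1 + (fst z)\<^sup>2 + (snd z)\<^sup>2) in Complex (fst z / W) (snd z / W))"

text \<open>The open unit disc.\<close>

definition disc :: "complex set" where
  "disc = {w. (Re w)\<^sup>2 + (Im w)\<^sup>2 < 1}"

lemma open_disc: "open disc"
  unfolding disc_def by (intro open_Collect_less continuous_intros)

lemma slope_slope_inv: "slope_inv z \<in> disc" "slope (slope_inv z) = z"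
proof -
  obtain p q where z: "z = (p, q)" by (cases z)
  define S where "S = sqrt (1 + p\<^sup>2 + q\<^sup>2)"
  have S: "S\<^sup>2 = 1 + p\<^sup>2 + q\<^sup>2" "S \<ge> 1"
    by (simp_all add: S_def add_nonneg_nonneg)
  have D: "1 - (p / (1 + S))\<^sup>2 - (q / (1 + S))\<^sup>2 = 2 / (1 + S)"
  proof -
    have "1 - (p / (1 + S))\<^sup>2 - (q / (1 + S))\<^sup>2 = ((1 + S)\<^sup>2 - p\<^sup>2 - q\<^sup>2) / (1 + S)\<^sup>2"
      using S(2) by (simp add: power_divide diff_divide_distrib)
    also have "(1 + S)\<^sup>2 - p\<^sup>2 - q\<^sup>2 = 2 * (1 + S)"
      using S(1) by (simp add: power2_eq_square algebra_simps)
    also have "\<dots> / (1 + S)\<^sup>2 = 2 / (1 + S)"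
      using S(2) by (simp only: power2_eq_square) (simp add: divide_simps)
    finally show ?thesis .
  qed
  have w: "slope_inv z = Complex (p / (1 + S)) (q / (1 + S))"
    by (simp add: slope_inv_def z S_def Let_def)
  have "0 < 1 - (p / (1 + S))\<^sup>2 - (q / (1 + S))\<^sup>2"
    unfolding D using S(2) by simp
  then show "slope_inv z \<in> disc"
    by (simp add: disc_def w)
  show "slope (slope_inv z) = z"
    using S(2) by (simp add: slope_def w D) (simp add: z)
qed

lemma slope_inv_slope:
  assumes "w \<in> disc"
  shows "slope_inv (slope w) = w"
proof -
  define a b where "a = Re w" and "b = Im w"
  define D where "D = 1 - a\<^sup>2 - b\<^sup>2"
  have D: "D > 0"
    using assms by (simp add: disc_def D_def a_def b_def)
  have "1 + (2 * a / D)\<^sup>2 + (2 * b / D)\<^sup>2 = (D\<^sup>2 + (2 * a)\<^sup>2 + (2 * b)\<^sup>2) / D\<^sup>2"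
    using D by (simp add: power_divide add_divide_distrib)
  also have "D\<^sup>2 + (2 * a)\<^sup>2 + (2 * b)\<^sup>2 = (2 - D)\<^sup>2"
    by (simp add: D_def power2_eq_square algebra_simps)
  also have "(2 - D)\<^sup>2 / D\<^sup>2 = ((2 - D) / D)\<^sup>2"
    by (simp add: power_divide)
  finally have "sqrt (1 + (2 * a / D)\<^sup>2 + (2 * b / D)\<^sup>2) = \<bar>(2 - D) / D\<bar>"
    by simp
  also have "\<dots> = (2 - D) / D"
  proof -
    have "D \<le> 2" by (simp add: D_def) (smt (verit) zero_le_power2)
    with D show ?thesis by simp
  qed
  finally have "1 + sqrt (1 + (2 * a / D)\<^sup>2 + (2 * b / D)\<^sup>2) = 2 / D"
    using D by (simp add: field_simps)
  moreover have "slope w = (2 * a / D, 2 * b / D)"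
    by (simp add: slope_def a_def b_def D_def)
  ultimately have "slope_inv (slope w) = Complex (2 * a / D / (2 / D)) (2 * b / D / (2 / D))"
    by (simp add: slope_inv_def Let_def)
  also have "\<dots> = w"
    using D by (simp add: a_def b_def)
  finally show ?thesis .
qed

lemma continuous_on_slope: "continuous_on disc slope"
  unfolding slope_def disc_def by (intro continuous_intros) auto

lemma continuous_on_slope_inv: "continuous_on S slope_inv"
proof -
  have "1 + sqrt (1 + (fst z)\<^sup>2 + (snd z)\<^sup>2) \<noteq> 0" for z :: "real \<times> real"
    by (smt (verit) real_sqrt_ge_zero zero_le_power2)
  then show ?thesis
    unfolding slope_inv_def Let_def Complex_eq by (intro continuous_intros) auto
qed

lemma slope_has_derivative:
  assumes "w \<in> disc" and D: "D = 1 - (Re w)\<^sup>2 - (Im w)\<^sup>2"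
  shows "((\<lambda>w. fst (slope w)) has_derivative
      (\<lambda>h. Re h * (2 * (1 + (Re w)\<^sup>2 - (Im w)\<^sup>2) / D\<^sup>2) + Im h * (4 * Re w * Im w / D\<^sup>2))) (at w)"
    and "((\<lambda>w. snd (slope w)) has_derivative
      (\<lambda>h. Re h * (4 * Re w * Im w / D\<^sup>2) + Im h * (2 * (1 - (Re w)\<^sup>2 + (Im w)\<^sup>2) / D\<^sup>2))) (at w)"
proof -
  have D0: "1 - (Re w)\<^sup>2 - (Im w)\<^sup>2 \<noteq> 0"
    using assms by (simp add: disc_def)
  have den: "((\<lambda>w. 1 - (Re w)\<^sup>2 - (Im w)\<^sup>2) has_derivative
      (\<lambda>h. - 2 * Re w * Re h - 2 * Im w * Im h)) (at w)"
    by (auto intro!: derivative_eq_intros)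
  have num: "((\<lambda>w. 2 * Re w) has_derivative (\<lambda>h. 2 * Re h)) (at w)"
    "((\<lambda>w. 2 * Im w) has_derivative (\<lambda>h. 2 * Im h)) (at w)"
    by (auto intro!: derivative_eq_intros)
  show "((\<lambda>w. fst (slope w)) has_derivative
      (\<lambda>h. Re h * (2 * (1 + (Re w)\<^sup>2 - (Im w)\<^sup>2) / D\<^sup>2) + Im h * (4 * Re w * Im w / D\<^sup>2))) (at w)"
    unfolding slope_def fst_conv
    by (rule has_derivative_eq_rhs[OF has_derivative_divide'[OF num(1) den D0]])
      (simp add: D[symmetric] fun_eq_iff power2_eq_square flip: add_divide_distrib,
        simp add: D power2_eq_square algebra_simps)
  show "((\<lambda>w. snd (slope w)) has_derivative
      (\<lambda>h. Re h * (4 * Re w * Im w / D\<^sup>2) + Im h * (2 * (1 - (Re w)\<^sup>2 + (Im w)\<^sup>2) / D\<^sup>2))) (at w)"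
    unfolding slope_def snd_conv
    by (rule has_derivative_eq_rhs[OF has_derivative_divide'[OF num(2) den D0]])
      (simp add: D[symmetric] fun_eq_iff power2_eq_square flip: add_divide_distrib,
        simp add: D power2_eq_square algebra_simps)
qed

text \<open>The Cauchy-Riemann equations imply complex differentiability.\<close>

lemma has_field_derivative_Complex:
  assumes "(f has_derivative (\<lambda>h. Re h * A + Im h * B)) (at w)"
    and "(g has_derivative (\<lambda>h. Re h * (- B) + Im h * A)) (at w)"
  shows "((\<lambda>w. Complex (f w) (g w)) has_field_derivative Complex A (- B)) (at w)"
proof -
  have "((\<lambda>w. of_real (f w) + \<i> * of_real (g w)) has_derivative
      (\<lambda>h. of_real (Re h * A + Im h * B) + \<i> * of_real (Re h * (- B) + Im h * A))) (at w)"
    by (intro has_derivative_add has_derivative_mult_right has_derivative_of_real assms)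
  also have "(\<lambda>h. of_real (Re h * A + Im h * B) + \<i> * of_real (Re h * (- B) + Im h * A))
      = (*) (Complex A (- B))"
    by (auto simp: fun_eq_iff complex_eq_iff algebra_simps)
  finally show ?thesis
    by (simp add: has_field_derivative_def Complex_eq)
qed

text \<open>The function \<open>\<partial>(\<phi>\<^sub>p - i \<phi>\<^sub>q)/\<partial>\<zeta>\<close>, that is, half of \<open>(\<partial>\<^sub>a - i \<partial>\<^sub>b) ((\<phi>\<^sub>p - i \<phi>\<^sub>q) \<circ> slope)\<close>, written
  out in terms of the second derivatives of \<open>\<phi>\<close>.\<close>

definition weierstrass :: "(real \<times> real \<Rightarrow> real) \<Rightarrow> complex \<Rightarrow> complex" where
  "weierstrass \<phi> w = Complex
    (((1 + (Re w)\<^sup>2 - (Im w)\<^sup>2) * pdx (pdx \<phi>) (slope w)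
        - (1 - (Re w)\<^sup>2 + (Im w)\<^sup>2) * pdy (pdy \<phi>) (slope w)) / (1 - (Re w)\<^sup>2 - (Im w)\<^sup>2)\<^sup>2)
    (- (2 * Re w * Im w * (pdx (pdx \<phi>) (slope w) + pdy (pdy \<phi>) (slope w))
        + 2 * pdx (pdy \<phi>) (slope w)) / (1 - (Re w)\<^sup>2 - (Im w)\<^sup>2)\<^sup>2)"

lemma has_derivative_divide_square:
  assumes f: "(f has_derivative (\<lambda>h. Re h * A + Im h * B)) (at w)"
    and D: "D = 1 - (Re w)\<^sup>2 - (Im w)\<^sup>2" "D \<noteq> 0"
  shows "((\<lambda>w. f w / (1 - (Re w)\<^sup>2 - (Im w)\<^sup>2)\<^sup>2) has_derivative
    (\<lambda>h. Re h * ((D * A + 4 * Re w * f w) / D ^ 3) + Im h * ((D * B + 4 * Im w * f w) / D ^ 3))) (at w)"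
proof -
  have den: "((\<lambda>w. (1 - (Re w)\<^sup>2 - (Im w)\<^sup>2)\<^sup>2) has_derivative
      (\<lambda>h. 2 * D * (- 2 * Re w * Re h - 2 * Im w * Im h))) (at w)"
    by (auto intro!: derivative_eq_intros simp: D(1) fun_eq_iff algebra_simps)
  have D0: "(1 - (Re w)\<^sup>2 - (Im w)\<^sup>2)\<^sup>2 \<noteq> 0"
    using D by simp
  show ?thesis
    by (rule has_derivative_eq_rhs[OF has_derivative_divide'[OF f den D0]])
      (use D(2) in \<open>simp add: D(1)[symmetric] fun_eq_iff divide_simps,
        simp add: power2_eq_square power3_eq_cube power4_eq_xxxx algebra_simps\<close>)
qed

text \<open>Each of the two Cauchy-Riemann equations for \<open>weierstrass \<phi>\<close> is a multiple of the
  equation for \<open>\<phi>\<close> differentiated once, with respect to \<open>p\<close> or to \<open>q\<close>.\<close>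

lemma weierstrass_holomorphic:
  assumes U: "open U" "Ck_on 3 U \<phi>"
    and eq: "\<And>w. w \<in> U \<Longrightarrow> (1 + (fst w)\<^sup>2) * pdx (pdx \<phi>) w
      + 2 * fst w * snd w * pdy (pdx \<phi>) w + (1 + (snd w)\<^sup>2) * pdy (pdy \<phi>) w = 0"
    and w: "w \<in> disc" "slope w \<in> U"
  shows "weierstrass \<phi> field_differentiable (at w)"
proof -
  have C: "Ck_on (Suc (Suc (Suc 0))) U \<phi>"
    using U(2) by (simp add: numeral_3_eq_3)
  have comm: "pdy (pdx \<phi>) v = pdx (pdy \<phi>) v"
    "pdy (pdx (pdx \<phi>)) v = pdx (pdy (pdx \<phi>)) v"
    "pdy (pdx (pdy \<phi>)) v = pdx (pdy (pdy \<phi>)) v" if "v \<in> U" for v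
    using C that U(1) by (auto intro!: mixed_partials_commute[of U] simp: numeral_2_eq_2
        differentiable_imp_continuous_within continuous_at_imp_continuous_on)
  define v where "v = slope w"
  have v: "v \<in> U" using w by (simp add: v_def)
  define r s t where "r = pdx (pdx \<phi>)" and "s = pdx (pdy \<phi>)" and "t = pdy (pdy \<phi>)"
  have diff: "r differentiable (at z)" "s differentiable (at z)" "t differentiable (at z)" if "z \<in> U" for z
    using C that by (auto simp: r_def s_def t_def)
  have c1: "pdx s v = pdy r v"
    using partials_cong(2)[OF U(1) v comm(1)] comm(2)[OF v] by (simp add: r_def s_def)
  have c2: "pdx t v = pdy s v"
    using comm(3)[OF v] by (simp add: s_def t_def)
  define p q where "p = fst v" and "q = snd v"
  have e: "(1 + p\<^sup>2) * pdx r v + 2 * p * r v + (2 * p * q * pdy r v + 2 * q * s v)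
      + (1 + q\<^sup>2) * pdy s v = 0"
    "(1 + p\<^sup>2) * pdy r v + (2 * p * q * pdy s v + 2 * p * s v)
      + ((1 + q\<^sup>2) * pdy t v + 2 * q * t v) = 0"
  proof -
    let ?E = "\<lambda>w. (1 + (fst w)\<^sup>2) * r w + 2 * fst w * snd w * s w + (1 + (snd w)\<^sup>2) * t w"
    have "?E z = 0" if "z \<in> U" for z
      using eq[OF that] comm(1)[OF that] by (simp add: r_def s_def t_def)
    note z = partials_zero[OF U(1) v, of ?E, OF this]
    have "(?E has_derivative (\<lambda>h.
        fst h * ((1 + p\<^sup>2) * pdx r v + 2 * p * r v + (2 * p * q * pdx s v + 2 * q * s v)
          + (1 + q\<^sup>2) * pdx t v)
      + snd h * ((1 + p\<^sup>2) * pdy r v + (2 * p * q * pdy s v + 2 * p * s v)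
          + ((1 + q\<^sup>2) * pdy t v + 2 * q * t v)))) (at v)"
      by (rule derivative_eq_intros has_derivative_partials diff v refl)+
        (simp add: p_def q_def fun_eq_iff algebra_simps)
    from partials_eqI(2,3)[OF this] z c1 c2
    show "(1 + p\<^sup>2) * pdx r v + 2 * p * r v + (2 * p * q * pdy r v + 2 * q * s v)
        + (1 + q\<^sup>2) * pdy s v = 0"
      "(1 + p\<^sup>2) * pdy r v + (2 * p * q * pdy s v + 2 * p * s v)
        + ((1 + q\<^sup>2) * pdy t v + 2 * q * t v) = 0"
      by simp_all
  qed
  define a b where "a = Re w" and "b = Im w"
  define D where "D = 1 - a\<^sup>2 - b\<^sup>2"
  have D: "D = 1 - (Re w)\<^sup>2 - (Im w)\<^sup>2" "D \<noteq> 0"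
    using w by (auto simp: D_def a_def b_def disc_def)
  have pq: "D * p = 2 * a" "D * q = 2 * b"
    using D(2) by (simp_all add: p_def q_def v_def slope_def flip: D(1), simp_all add: a_def b_def)
  define pa pb qb where "pa = 2 * (1 + a\<^sup>2 - b\<^sup>2) / D\<^sup>2" and "pb = 4 * a * b / D\<^sup>2"
    and "qb = 2 * (1 - a\<^sup>2 + b\<^sup>2) / D\<^sup>2"
  have jac: "D\<^sup>2 * pa = 2 * (1 + a\<^sup>2 - b\<^sup>2)" "D\<^sup>2 * pb = 4 * a * b"
    "D\<^sup>2 * qb = 2 * (1 - a\<^sup>2 + b\<^sup>2)"
    using D(2) by (simp_all add: pa_def pb_def qb_def)
  have comp: "((\<lambda>w. g (slope w)) has_derivative
      (\<lambda>h. Re h * (pa * pdx g v + pb * pdy g v) + Im h * (pb * pdx g v + qb * pdy g v))) (at w)"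
    if "g differentiable (at v)" for g
    using has_derivative_compose_pair[of g "\<lambda>w. fst (slope w)" w "\<lambda>w. snd (slope w)",
        OF _ slope_has_derivative[OF w(1) D(1)]] that
    by (simp add: v_def a_def b_def pa_def pb_def qb_def algebra_simps)
  \<comment> \<open>Partial derivatives of the numerators of the real part and of minus the imaginary part.\<close>
  define xa xb ya yb where
    "xa = 2 * a * r v + (1 + a\<^sup>2 - b\<^sup>2) * (pa * pdx r v + pb * pdy r v)
      + 2 * a * t v - (1 - a\<^sup>2 + b\<^sup>2) * (pa * pdy s v + pb * pdy t v)" and
    "xb = - 2 * b * r v + (1 + a\<^sup>2 - b\<^sup>2) * (pb * pdx r v + qb * pdy r v)
      - 2 * b * t v - (1 - a\<^sup>2 + b\<^sup>2) * (pb * pdy s v + qb * pdy t v)" and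
    "ya = 2 * b * (r v + t v) + 2 * a * b * (pa * (pdx r v + pdy s v) + pb * (pdy r v + pdy t v))
      + 2 * (pa * pdy r v + pb * pdy s v)" and
    "yb = 2 * a * (r v + t v) + 2 * a * b * (pb * (pdx r v + pdy s v) + qb * (pdy r v + pdy t v))
      + 2 * (pb * pdy r v + qb * pdy s v)"
  define x where "x w = (1 + (Re w)\<^sup>2 - (Im w)\<^sup>2) * r (slope w) - (1 - (Re w)\<^sup>2 + (Im w)\<^sup>2) * t (slope w)"
    for w
  define y where "y w = - (2 * Re w * Im w * (r (slope w) + t (slope w)) + 2 * s (slope w))" for w
  have "(x has_derivative (\<lambda>h. Re h * xa + Im h * xb)) (at w)"
    unfolding x_def
    by (rule derivative_eq_intros comp diff v refl)+
      (simp add: xa_def xb_def a_def b_def c2 flip: v_def, simp add: fun_eq_iff algebra_simps)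
  note dx = has_derivative_divide_square[OF this D]
  have "(y has_derivative (\<lambda>h. Re h * (- ya) + Im h * (- yb))) (at w)"
    unfolding y_def
    by (rule derivative_eq_intros comp diff v refl)+
      (simp add: ya_def yb_def a_def b_def c1 c2 flip: v_def, simp add: fun_eq_iff algebra_simps)
  note dy = has_derivative_divide_square[OF this D]
  have xw: "x w = (1 + a\<^sup>2 - b\<^sup>2) * r v - (1 - a\<^sup>2 + b\<^sup>2) * t v"
    and yw: "y w = - (2 * a * b * (r v + t v) + 2 * s v)"
    by (simp_all add: x_def y_def a_def b_def v_def)
  \<comment> \<open>The differentiated equation, freed of the denominators of \<open>p\<close> and \<open>q\<close>.\<close>
  have e': "(D\<^sup>2 + 4 * a\<^sup>2) * pdx r v + 8 * a * b * pdy r v + (D\<^sup>2 + 4 * b\<^sup>2) * pdy s v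
      + D * (4 * a * r v + 4 * b * s v) = 0"
    "(D\<^sup>2 + 4 * a\<^sup>2) * pdy r v + 8 * a * b * pdy s v + (D\<^sup>2 + 4 * b\<^sup>2) * pdy t v
      + D * (4 * a * s v + 4 * b * t v) = 0"
    using e pq by algebra+
  have "D\<^sup>2 * ((D * xa + 4 * a * x w) - (D * (- yb) + 4 * b * y w)) = 0"
    unfolding xw yw xa_def yb_def using e'(1) jac D_def by algebra
  then have 1: "D * (- yb) + 4 * b * y w = D * xa + 4 * a * x w"
    using D(2) by simp
  have "D\<^sup>2 * ((D * xb + 4 * b * x w) + (D * (- ya) + 4 * a * y w)) = 0"
    unfolding xw yw xb_def ya_def using e'(2) jac D_def by algebra
  then have 2: "D * (- ya) + 4 * a * y w = - (D * xb + 4 * b * x w)"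
    using D(2) by simp
  have weierstrass: "weierstrass \<phi> = (\<lambda>w. Complex (x w / (1 - (Re w)\<^sup>2 - (Im w)\<^sup>2)\<^sup>2)
      (y w / (1 - (Re w)\<^sup>2 - (Im w)\<^sup>2)\<^sup>2))"
    by (simp add: fun_eq_iff weierstrass_def x_def y_def r_def s_def t_def)
  have "(weierstrass \<phi> has_field_derivative
      Complex ((D * xa + 4 * a * x w) / D ^ 3) (- ((D * xb + 4 * b * x w) / D ^ 3))) (at w)"
    unfolding weierstrass
    using has_field_derivative_Complex[OF dx[folded a_def b_def]
        dy[folded a_def b_def, unfolded 1 2 minus_divide_left[symmetric]]] .
  then show ?thesis
    by (auto simp: field_differentiable_def)
qed

text \<open>The vanishing of \<open>weierstrass \<phi>\<close> and the equation for \<open>\<phi>\<close> are three linear equations for the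
  second derivatives of \<open>\<phi>\<close>; they are independent inside the unit disc.\<close>

lemma weierstrass_zero_imp:
  assumes "weierstrass \<phi> w = 0" "w \<in> disc"
    and eq: "(1 + (fst (slope w))\<^sup>2) * pdx (pdx \<phi>) (slope w)
      + 2 * fst (slope w) * snd (slope w) * pdx (pdy \<phi>) (slope w)
      + (1 + (snd (slope w))\<^sup>2) * pdy (pdy \<phi>) (slope w) = 0"
  shows "pdx (pdx \<phi>) (slope w) = 0" "pdx (pdy \<phi>) (slope w) = 0" "pdy (pdy \<phi>) (slope w) = 0"
proof -
  define a b where "a = Re w" and "b = Im w"
  define D where "D = 1 - a\<^sup>2 - b\<^sup>2"
  have D: "D = 1 - (Re w)\<^sup>2 - (Im w)\<^sup>2" "D > 0"
    using assms(2) by (auto simp: D_def a_def b_def disc_def)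
  define p q where "p = fst (slope w)" and "q = snd (slope w)"
  have pq: "D * p = 2 * a" "D * q = 2 * b"
    using D(2) by (simp_all add: p_def q_def slope_def flip: D(1), simp_all add: a_def b_def)
  define r s t where "r = pdx (pdx \<phi>) (slope w)" and "s = pdx (pdy \<phi>) (slope w)"
    and "t = pdy (pdy \<phi>) (slope w)"
  have "Complex (((1 + a\<^sup>2 - b\<^sup>2) * r - (1 - a\<^sup>2 + b\<^sup>2) * t) / D\<^sup>2)
      (- (2 * a * b * (r + t) + 2 * s) / D\<^sup>2) = 0"
    using assms(1) by (simp only: weierstrass_def a_def b_def r_def s_def t_def D(1))
  then have h: "(1 + a\<^sup>2 - b\<^sup>2) * r - (1 - a\<^sup>2 + b\<^sup>2) * t = 0" "2 * a * b * (r + t) + 2 * s = 0"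
    using D(2) unfolding complex_eq_iff by (simp_all del: right_diff_distrib)
  have "(1 + p\<^sup>2) * r + 2 * p * q * s + (1 + q\<^sup>2) * t = 0"
    using eq by (simp add: p_def q_def r_def s_def t_def)
  then have e: "(D\<^sup>2 + 4 * a\<^sup>2) * r + 8 * a * b * s + (D\<^sup>2 + 4 * b\<^sup>2) * t = 0"
    using pq by algebra
  have s: "s = - a * b * (r + t)"
    using h(2) by (simp add: algebra_simps)
  have "D * (2 - D) * (r + t) = 0"
    using e s h(1) D_def by algebra
  moreover have "D < 2" 
    by (simp add: D_def) (smt (verit) zero_le_power2)
  ultimately have rt: "r + t = 0"
    using D(2) by simp
  then have "2 * r = 0" using h(1) by algebra
  then show "pdx (pdx \<phi>) (slope w) = 0" "pdx (pdy \<phi>) (slope w) = 0" "pdy (pdy \<phi>) (slope w) = 0"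
    using rt s by (simp_all add: r_def s_def t_def)
qed

lemma symmetry_unique_continuation:
  assumes U: "open U" "connected U" "Ck_on 3 U \<phi>"
    and eq: "\<And>w. w \<in> U \<Longrightarrow> (1 + (fst w)\<^sup>2) * pdx (pdx \<phi>) w
      + 2 * fst w * snd w * pdy (pdx \<phi>) w + (1 + (snd w)\<^sup>2) * pdy (pdy \<phi>) w = 0"
    and N: "open N" "N \<noteq> {}" "N \<subseteq> U" "\<And>w. w \<in> N \<Longrightarrow> \<phi> w = 0"
    and "w \<in> U"
  shows "\<phi> w = 0"
proof -
  have C: "Ck_on (Suc (Suc (Suc 0))) U \<phi>" "Ck_on 2 U \<phi>"
    using U(3) by (simp_all add: numeral_3_eq_3 numeral_2_eq_2 continuous_on_if_differentiable)
  have comm: "pdy (pdx \<phi>) z = pdx (pdy \<phi>) z" if "z \<in> U" for z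
    using mixed_partials_commute[OF U(1) C(2) that] .
  have grad: "pdx \<phi> z = 0" "pdy \<phi> z = 0" if "z \<in> N" for z
    using partials_zero[OF N(1) that, of \<phi>] N(4) by blast+
  have hess: "pdx (pdx \<phi>) z = 0" "pdx (pdy \<phi>) z = 0" "pdy (pdy \<phi>) z = 0" if "z \<in> N" for z
    using partials_zero[OF N(1) that, of "pdx \<phi>"] partials_zero[OF N(1) that, of "pdy \<phi>"] grad by blast+
  define G where "G = disc \<inter> slope -` U"
  have "G = slope_inv ` U"
    using slope_slope_inv slope_inv_slope by (force simp: G_def)
  then have "connected G"
    using connected_continuous_image[OF continuous_on_slope_inv U(2)] by simp
  moreover have "open G" "open (disc \<inter> slope -` N)"
    unfolding G_def using continuous_open_preimage[OF continuous_on_slope open_disc] U(1) N(1) by auto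
  moreover have "disc \<inter> slope -` N \<noteq> {}"
    using N(2) slope_slope_inv by (metis Int_iff all_not_in_conv vimageI)
  moreover have "disc \<inter> slope -` N \<subseteq> G"
    using N(3) by (auto simp: G_def)
  moreover have "weierstrass \<phi> holomorphic_on G"
    unfolding holomorphic_on_def G_def
    using weierstrass_holomorphic[OF U(1,3) eq] field_differentiable_at_within by blast
  moreover have "weierstrass \<phi> z = 0" if "z \<in> disc \<inter> slope -` N" for z
    using hess that by (simp add: weierstrass_def Complex_eq_0)
  ultimately have weierstrass: "weierstrass \<phi> z = 0" if "z \<in> G" for z
    using analytic_continuation_open[of "disc \<inter> slope -` N" G "weierstrass \<phi>" "\<lambda>_. 0"] that by simp
  have hess0: "pdx (pdx \<phi>) z = 0" "pdx (pdy \<phi>) z = 0" "pdy (pdy \<phi>) z = 0" if "z \<in> U" for z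
  proof -
    have "slope_inv z \<in> G"
      using that slope_slope_inv by (simp add: G_def)
    then show "pdx (pdx \<phi>) z = 0" "pdx (pdy \<phi>) z = 0" "pdy (pdy \<phi>) z = 0"
      using weierstrass_zero_imp[of \<phi> "slope_inv z"] weierstrass eq[OF that] comm[OF that] slope_slope_inv[of z]
      by simp_all
  qed
  obtain n where n: "n \<in> N" "n \<in> U"
    using N(2,3) by blast
  have "pdx \<phi> z = 0" "pdy \<phi> z = 0" if "z \<in> U" for z
    using partials_zero_imp_constant[OF U(1,2), of "pdx \<phi>" z n]
      partials_zero_imp_constant[OF U(1,2), of "pdy \<phi>" z n] C(1) hess0 comm grad[OF n(1)] n(2) that
    by simp_all
  then show ?thesis
    using partials_zero_imp_constant[OF U(1,2), of \<phi> w n] C(1) N(4)[OF n(1)] n(2) \<open>w \<in> U\<close> by simp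
qed

section \<open>The Hessian of the surface\<close>

lemma minimal_hessian_zero:
  fixes p q A B C :: real
  assumes "(1 + q\<^sup>2) * A - 2 * p * q * B + (1 + p\<^sup>2) * C = 0" "A * C - B * B = 0"
  shows "A = 0" "B = 0" "C = 0"
proof -
  \<comment> \<open>\<open>A\<close> times the first equation, with \<open>B\<^sup>2\<close> substituted for \<open>A C\<close>, is a sum of squares.\<close>
  have "(q * A - p * B)\<^sup>2 + A\<^sup>2 + B\<^sup>2 = 0"
    using assms by algebra
  then show A: "A = 0" and B: "B = 0"
    by (smt (verit) zero_le_power2 power2_eq_iff_nonneg zero_eq_power2)+
  have "1 + p\<^sup>2 > 0"
    by (simp add: add_pos_nonneg)
  then show "C = 0"
    using assms(1) A B by simp
qed

lemma gradient_image_interior: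
  assumes "open D" "Ck_on 2 D u" "z \<in> D"
    and det: "pdx (pdx u) z * pdy (pdy u) z - pdy (pdx u) z * pdy (pdx u) z \<noteq> 0"
  shows "(pdx u z, pdy u z) \<in> interior ((\<lambda>z. (pdx u z, pdy u z)) ` D)"
proof -
  define A B C where "A = pdx (pdx u) z" and "B = pdy (pdx u) z" and "C = pdy (pdy u) z"
  have B: "pdx (pdy u) z = B"
    using mixed_partials_commute[OF assms(1-3)] by (simp add: B_def)
  have C2: "Ck_on (Suc (Suc 0)) D u"
    using assms(2) by (simp add: numeral_2_eq_2)
  have diff: "pdx u differentiable (at w)" "pdy u differentiable (at w)" if "w \<in> D" for w
    using C2 that by auto
  define d where "d = A * C - B * B"
  have d: "d \<noteq> 0"
    using det by (simp add: d_def A_def B_def C_def)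
  let ?g = "\<lambda>z. (pdx u z, pdy u z)"
  let ?g' = "\<lambda>h. (fst h * A + snd h * B, fst h * B + snd h * C)"
  let ?k = "\<lambda>h. ((C * fst h - B * snd h) / d, (A * snd h - B * fst h) / d)"
  have "continuous_on D ?g"
    using diff by (intro continuous_on_Pair continuous_on_if_differentiable)
  moreover have "(?g has_derivative ?g') (at z)"
    using has_derivative_Pair[OF has_derivative_partials[OF diff(1)[OF assms(3)]]
        has_derivative_partials[OF diff(2)[OF assms(3)]]]
    by (simp add: A_def B C_def flip: B_def)
  moreover have "bounded_linear ?k"
    unfolding linear_conv_bounded_linear[symmetric]
    by (rule linearI) (simp_all add: algebra_simps add_divide_distrib diff_divide_distrib)
  moreover have "?g' \<circ> ?k = id"
  proof
    fix h :: "real \<times> real"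
    have "(C * fst h - B * snd h) * A + (A * snd h - B * fst h) * B = fst h * d"
      "(C * fst h - B * snd h) * B + (A * snd h - B * fst h) * C = snd h * d"
      by (simp_all add: d_def algebra_simps)
    then show "(?g' \<circ> ?k) h = id h"
      using d by (simp add: prod_eq_iff flip: add_divide_distrib)
  qed
  ultimately show ?thesis
    using sussmann_open_mapping[of D ?g z ?g' ?k D] assms(1,3) by (simp add: interior_open)
qed

theorem proposition5:
  fixes u \<phi> :: "real \<times> real \<Rightarrow> real" and D U :: "(real \<times> real) set"
  assumes "minimal_graph D u"
    and "contact_symmetry U \<phi>"
    and "\<exists>w\<in>U. \<phi> w \<noteq> 0"
    and "invariant_graph D u U \<phi>"
  shows "planar_graph D u"
proof -
  have D: "open D" "connected D" "Ck_on 2 D u" "\<And>z. z \<in> D \<Longrightarrow> mse u z = 0"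
    using assms(1) by (auto simp: minimal_graph_def smooth_on_def)
  have U: "open U" "connected U" "Ck_on 3 U \<phi>"
    using assms(2) unfolding contact_symmetry_def smooth_on_def by blast+
  let ?g = "\<lambda>z. (pdx u z, pdy u z)"
  have inv: "w \<in> U" "\<phi> w = 0" if "w \<in> ?g ` D" for w
    using assms(4) that by (auto simp: invariant_graph_def)
  have det: "pdx (pdx u) z * pdy (pdy u) z - pdy (pdx u) z * pdy (pdx u) z = 0" if z: "z \<in> D" for z
  proof (rule ccontr)
    assume "pdx (pdx u) z * pdy (pdy u) z - pdy (pdx u) z * pdy (pdx u) z \<noteq> 0"
    then have "interior (?g ` D) \<noteq> {}"
      using gradient_image_interior[OF D(1,3) z] by blast
    moreover have "interior (?g ` D) \<subseteq> U" "\<And>w. w \<in> interior (?g ` D) \<Longrightarrow> \<phi> w = 0"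
      using inv interior_subset by blast+
    ultimately have "\<phi> w = 0" if "w \<in> U" for w
      using symmetry_unique_continuation[OF U contact_symmetry_equation[OF assms(2)] open_interior]
        that by blast
    with assms(3) show False by blast
  qed
  have hess: "pdx (pdx u) z = 0" "pdy (pdx u) z = 0" "pdx (pdy u) z = 0" "pdy (pdy u) z = 0"
    if "z \<in> D" for z
    using minimal_hessian_zero[OF D(4)[OF that, unfolded mse_def] det[OF that]]
      mixed_partials_commute[OF D(1,3) that] by simp_all
  have diff: "pdx u differentiable (at z)" "pdy u differentiable (at z)" if "z \<in> D" for z
    using D(3) that by (simp_all add: numeral_2_eq_2)
  have "pdx u z = pdx u w \<and> pdy u z = pdy u w" if "z \<in> D" "w \<in> D" for z w
    using partials_zero_imp_constant[OF D(1,2) _ _ _ that] diff hess by blast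
  then show ?thesis
    unfolding planar_graph_def by metis
qed

end
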